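(* Let $L>0$, $n\ge 1$, and let $f(\cdot;1),\dots,f(\cdot;n):\mathbb{R}^d\to\mathbb{R}$ be convex differentiable functions such that $\|\nabla f(x;i)-\nabla f(y;i)\|\le L\|x-y\|$ for all $x,y\in\mathbb{R}^d$ and $i\in\{1,\dots,n\}$. Let $F(w)=\frac1n\sum_{i=1}^n f(w;i)$, assume $F$ has a minimizer, let $x_*$ be any minimizer of $F$, and let $\sigma_*^2=\frac1n\sum_{i=1}^n\|\nabla f(x_*;i)\|^2$. Let the iterates be generated by the NASG algorithm, run for $T$ epochs from chosen initial points $\tilde x_0,\tilde y_0\in\mathbb{R}^d$, with an arbitrary permutation $\pi^{(t)}$ of $\{1,\dots,n\}$ in each epoch $t$, with parameter $\gamma_t=\frac{t-1}{t+2}$ and learning rate $\eta_i^{(t)}:=\frac{\eta_t}{n}>0$ for $\eta_t=\frac{k\alpha^t}{LT}\le\frac1L$, where $k=\frac{1}{e\,\alpha\,\sqrt[3]{12}}>0$ and $\alpha=1+\frac1T>0$. Then for $T\ge 2$, $$F(\tilde x_T)-F(x_* )\le \frac{4\sigma_*^2}{9LT}+\frac{2Le\sqrt[3]{12}}{T}\,\|\tilde x_0-x_*\|^2 .$$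
   Context: NASG (Nesterov Accelerated Shuffling Gradient) algorithm: choose initial points $\tilde x_0,\tilde y_0\in\mathbb{R}^d$; given parameters $\gamma_t$ and learning rates $\eta_i^{(t)}>0$, for each epoch $t=1,2,\dots,T$: set $y_0^{(t)}:=\tilde y_{t-1}$; generate any permutation $\pi^{(t)}$ of $\{1,\dots,n\}$ (either deterministic or random); for $i=1,\dots,n$ set $y_i^{(t)}:=y_{i-1}^{(t)}-\eta_i^{(t)}\nabla f(y_{i-1}^{(t)};\pi^{(t)}(i))$; then set $\tilde x_t:=y_n^{(t)}$ and $\tilde y_t:=\tilde x_t+\gamma_t(\tilde x_t-\tilde x_{t-1})$. Here $e$ is Euler's number and $T$ is the (integer) number of epochs. The result holds deterministically for every choice of permutations.
   Formalization: The initial points are assumed to agree, ỹ₀ = x̃₀; for independent initial points the bound is false, since γ₁ = 0 makes the iterates independent of x̃₀ (e.g. f(x) = x²/2, x̃₀ = x_* = 0, ỹ₀ = 1). *)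

theory Defs
  imports "HOL-Analysis.Analysis"
begin

definition objective :: "nat \<Rightarrow> (nat \<Rightarrow> 'a \<Rightarrow> real) \<Rightarrow> 'a \<Rightarrow> real" where
  "objective n f w = (1 / real n) * (\<Sum>i = 1..n. f i w)"

text \<open>The quantity written $\sigma_*^2$ when evaluated at a minimizer of the objective;
  \<open>g i\<close> is the gradient of the \<open>i\<close>-th component function.\<close>

definition grad_variance :: "nat \<Rightarrow> (nat \<Rightarrow> 'a \<Rightarrow> 'a :: real_normed_vector) \<Rightarrow> 'a \<Rightarrow> real" where
  "grad_variance n g z = (1 / real n) * (\<Sum>i = 1..n. (norm (g i z))\<^sup>2)"

text \<open>One epoch: \<open>nasg_inner g h p y i\<close> is the \<open>i\<close>-th inner iterate started at \<open>y\<close>, with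
  learning rates \<open>h 1, h 2, \<dots>\<close> and with the components visited in the order
  \<open>p 1, p 2, \<dots>\<close>.\<close>

primrec nasg_inner ::
  "(nat \<Rightarrow> 'a \<Rightarrow> 'a :: real_vector) \<Rightarrow> (nat \<Rightarrow> real) \<Rightarrow> (nat \<Rightarrow> nat) \<Rightarrow> 'a \<Rightarrow> nat \<Rightarrow> 'a"
where
  "nasg_inner g h p y 0 = y"
| "nasg_inner g h p y (Suc i) =
     nasg_inner g h p y i - h (Suc i) *\<^sub>R g (p (Suc i)) (nasg_inner g h p y i)"

text \<open>Outer iteration: \<open>nasg n g \<gamma> h \<pi> x0 y0 t\<close> is the pair
  $(\tilde x_t, \tilde y_t)$. The arguments \<open>\<gamma> t\<close>, \<open>h t i\<close> and \<open>\<pi> t\<close> are those of epoch \<open>t\<close>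
  and matter for \<open>t \<ge> 1\<close> only. If \<open>\<gamma> 1 = 0\<close>, the iterates from epoch 1 on depend on \<open>y0\<close>
  but not on \<open>x0\<close>, so a bound in terms of the distance of \<open>x0\<close> to a minimizer needs
  \<open>x0\<close> and \<open>y0\<close> to be related; the usual initialization is \<open>y0 = x0\<close>.\<close>

primrec nasg ::
  "nat \<Rightarrow> (nat \<Rightarrow> 'a \<Rightarrow> 'a :: real_vector) \<Rightarrow> (nat \<Rightarrow> real) \<Rightarrow> (nat \<Rightarrow> nat \<Rightarrow> real) \<Rightarrow>
   (nat \<Rightarrow> nat \<Rightarrow> nat) \<Rightarrow> 'a \<Rightarrow> 'a \<Rightarrow> nat \<Rightarrow> 'a \<times> 'a"
where
  "nasg n g \<gamma> h \<pi> x0 y0 0 = (x0, y0)"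
| "nasg n g \<gamma> h \<pi> x0 y0 (Suc t) =
     (let (x, y) = nasg n g \<gamma> h \<pi> x0 y0 t;
          x' = nasg_inner g (h (Suc t)) (\<pi> (Suc t)) y n
      in (x', x' + \<gamma> (Suc t) *\<^sub>R (x' - x)))"

end

theory Submission imports Defs begin

text \<open>Write \<open>G\<close> for the average of the gradients used in an epoch, so that the epoch is the step
  \<open>x' = y - \<eta> G\<close>. Smoothness and convexity of each component at its own inner iterate \<open>y\<^sub>i\<close> give
  \<open>F x' - F u \<le> G \<bullet> (x' - u)\<close> up to the mean of \<open>L/2 |x' - y\<^sub>i|\<^sup>2\<close>, minus the mean of
  \<open>|g\<^sub>i u - g\<^sub>i y\<^sub>i|\<^sup>2 / (2 L)\<close>. With \<open>D\<close> the mean of \<open>|g\<^sub>i x\<^sub>* - g\<^sub>i y\<^sub>i|\<^sup>2\<close>, the drift term is at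
  most \<open>L \<eta>\<^sup>2 (D + \<sigma>\<^sub>*\<^sup>2)\<close>. Mixing \<open>u = x\<close> and \<open>u = x\<^sub>*\<close> with Nesterov's weights \<open>1 - \<theta>\<close>, \<open>\<theta>\<close>, the
  gain \<open>\<theta> D / (2 L)\<close> absorbs \<open>L \<eta>\<^sup>2 D\<close>, because \<open>L \<eta> \<le> 1 / (2 T)\<close> while \<open>\<theta> \<ge> 1 / T\<close>. Dividing the
  resulting estimate of epoch \<open>t\<close> by \<open>\<alpha>\<^sup>t\<close> makes the growing step sizes constant, the distance
  terms still telescope since \<open>\<alpha> \<ge> 1\<close>, and the potential
  \<open>c ((t + 1)\<^sup>2 - 1) / 4 (F x\<^sub>t - F x\<^sub>*) + |v\<^sub>t - x\<^sub>*|\<^sup>2 / (2 \<alpha>\<^sup>t)\<close> increases by at most a noise term in \<open>\<sigma>\<^sub>*\<^sup>2\<close>.\<close>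

section \<open>Inequalities for smooth and convex functions\<close>

text \<open>Subtracting the linear and quadratic terms along the segment from \<open>x\<close> to
  \<open>y\<close> leaves \<open>\<phi>\<close>, whose derivative is nonpositive by Cauchy-Schwarz
  and the Lipschitz bound.\<close>

lemma smooth_upper_bound:
  fixes f :: "'a :: euclidean_space \<Rightarrow> real"
  assumes deriv: "\<And>x. GDERIV f x :> g x"
    and lip: "\<And>x y. norm (g x - g y) \<le> L * norm (x - y)"
  shows "f y \<le> f x + g x \<bullet> (y - x) + L / 2 * (norm (y - x))\<^sup>2"
proof -
  define d where "d = y - x"
  define \<phi> where "\<phi> s = f (x + s *\<^sub>R d) - s * (g x \<bullet> d) - L / 2 * s\<^sup>2 * (norm d)\<^sup>2" for s
  have "\<phi> 1 \<le> \<phi> 0"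
  proof (rule DERIV_nonpos_imp_nonincreasing[where a = 0 and b = 1 and f = \<phi>])
    fix s :: real assume s: "0 \<le> s" "s \<le> 1"
    have fd: "(f has_derivative (\<lambda>h. g (x + s *\<^sub>R d) \<bullet> h)) (at (x + s *\<^sub>R d))"
      using deriv[of "x + s *\<^sub>R d"] by (simp add: gderiv_def inner_commute)
    have "((\<lambda>s. f (x + s *\<^sub>R d)) has_derivative (\<lambda>h. g (x + s *\<^sub>R d) \<bullet> (h *\<^sub>R d))) (at s)"
      by (rule has_derivative_compose[where f = "\<lambda>s. x + s *\<^sub>R d" and g = f, OF _ fd])
        (auto intro!: derivative_eq_intros)
    then have "((\<lambda>s. f (x + s *\<^sub>R d)) has_real_derivative g (x + s *\<^sub>R d) \<bullet> d) (at s)"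
      by (simp add: has_field_derivative_def mult.commute[of _ "g (x + s *\<^sub>R d) \<bullet> d"] fun_eq_iff)
    then have "(\<phi> has_real_derivative
        g (x + s *\<^sub>R d) \<bullet> d - g x \<bullet> d - L * s * (norm d)\<^sup>2) (at s)"
      unfolding \<phi>_def by (auto intro!: derivative_eq_intros)
    moreover have "(g (x + s *\<^sub>R d) - g x) \<bullet> d \<le> norm (g (x + s *\<^sub>R d) - g x) * norm d"
      by (rule norm_cauchy_schwarz)
    moreover have "norm (g (x + s *\<^sub>R d) - g x) * norm d \<le> (L * (s * norm d)) * norm d"
      using lip[of "x + s *\<^sub>R d" x] s by (intro mult_right_mono) auto
    ultimately show "\<exists>D. (\<phi> has_real_derivative D) (at s) \<and> D \<le> 0"
      by (intro exI conjI) (auto simp: inner_diff_left power2_eq_square algebra_simps)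
  qed simp
  then show ?thesis by (simp add: \<phi>_def d_def)
qed

text \<open>Restriction to the line through \<open>x\<close> and \<open>y\<close> reduces this to
  the tangent inequality for convex functions of one real variable.\<close>

lemma convex_gradient_lower_bound:
  fixes f :: "'a :: euclidean_space \<Rightarrow> real"
  assumes deriv: "GDERIV f x :> c" and conv: "convex_on UNIV f"
  shows "f y \<ge> f x + c \<bullet> (y - x)"
proof -
  define d where "d = y - x"
  have fd: "(f has_derivative (\<lambda>h. c \<bullet> h)) (at (x + 0 *\<^sub>R d))"
    using deriv by (simp add: gderiv_def inner_commute)
  have "((\<lambda>s::real. f (x + s *\<^sub>R d)) has_derivative (\<lambda>h. c \<bullet> (h *\<^sub>R d))) (at 0)"
    by (rule has_derivative_compose[where f = "\<lambda>s. x + s *\<^sub>R d" and g = f, OF _ fd])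
        (auto intro!: derivative_eq_intros)
  then have der: "((\<lambda>s::real. f (x + s *\<^sub>R d)) has_real_derivative c \<bullet> d) (at 0)"
    by (simp add: has_field_derivative_def mult.commute[of _ "c \<bullet> d"] fun_eq_iff)
  have "convex_on UNIV (\<lambda>s::real. f (x + s *\<^sub>R d))"
  proof (rule convex_onI)
    fix t a b :: real assume "0 < t" "t < 1"
    moreover have "x + ((1 - t) *\<^sub>R a + t *\<^sub>R b) *\<^sub>R d = (1 - t) *\<^sub>R (x + a *\<^sub>R d) + t *\<^sub>R (x + b *\<^sub>R d)"
      by (simp add: algebra_simps)
    ultimately show "f (x + ((1 - t) *\<^sub>R a + t *\<^sub>R b) *\<^sub>R d)
        \<le> (1 - t) * f (x + a *\<^sub>R d) + t * f (x + b *\<^sub>R d)"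
      using convex_onD[OF conv, of t "x + a *\<^sub>R d" "x + b *\<^sub>R d"] by simp
  qed simp
  from convex_on_imp_above_tangent[OF this, of 0 1 "c \<bullet> d"] der show ?thesis
    by (simp add: d_def)
qed

lemma smooth_convex_lower_bound:
  fixes f :: "'a :: euclidean_space \<Rightarrow> real"
  assumes deriv: "\<And>x. GDERIV f x :> g x"
    and lip: "\<And>x y. norm (g x - g y) \<le> L * norm (x - y)"
    and conv: "convex_on UNIV f" and "L > 0"
  shows "f y \<ge> f x + g x \<bullet> (y - x) + (norm (g y - g x))\<^sup>2 / (2 * L)"
proof -
  \<comment> \<open>A gradient step from \<open>y\<close> on the convex function \<open>f - g x \<bullet> _\<close>, which is minimal at \<open>x\<close>.\<close>
  define d where "d = g y - g x"
  define z where "z = y - (1 / L) *\<^sub>R d"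
  have "f x + g x \<bullet> (z - x) \<le> f z"
    using convex_gradient_lower_bound[OF deriv conv] .
  also have "\<dots> \<le> f y + g y \<bullet> (z - y) + L / 2 * (norm (z - y))\<^sup>2"
    by (rule smooth_upper_bound[OF deriv lip])
  also have "g y \<bullet> (z - y) = g x \<bullet> (z - y) - (norm d)\<^sup>2 / L"
    by (simp add: z_def d_def power2_norm_eq_inner algebra_simps
        diff_divide_distrib add_divide_distrib)
  also have "L / 2 * (norm (z - y))\<^sup>2 = (norm d)\<^sup>2 / (2 * L)"
    using \<open>L > 0\<close> by (simp add: z_def power_divide power2_eq_square)
  also have "(norm d)\<^sup>2 / L = (norm d)\<^sup>2 / (2 * L) + (norm d)\<^sup>2 / (2 * L)"
    by (simp add: field_simps)
  finally show ?thesis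
    by (simp add: d_def inner_diff_right)
qed

section \<open>Inner iterates and norm estimates\<close>

lemma nasg_inner_eq_sum:
  assumes "\<And>j. j \<in> {1..i} \<Longrightarrow> h j = c"
  shows "nasg_inner g h p y i = y - c *\<^sub>R (\<Sum>j = 1..i. g (p j) (nasg_inner g h p y (j - 1)))"
  using assms by (induction i) (simp_all add: algebra_simps)

lemma norm_sum_power2_le:
  fixes v :: "'i \<Rightarrow> 'a :: real_normed_vector"
  shows "(norm (sum v A))\<^sup>2 \<le> real (card A) * (\<Sum>i\<in>A. (norm (v i))\<^sup>2)"
proof -
  have "(norm (sum v A))\<^sup>2 \<le> (\<Sum>i\<in>A. norm (v i))\<^sup>2"
    by (intro power_mono norm_sum) simp
  also have "\<dots> \<le> real (card A) * (\<Sum>i\<in>A. (norm (v i))\<^sup>2)"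
    using Cauchy_Schwarz_ineq_sum[of "\<lambda>_. 1" "\<lambda>i. norm (v i)" A] by simp
  finally show ?thesis .
qed

lemma norm_power2_le_double:
  fixes a b :: "'a :: real_inner"
  shows "(norm a)\<^sup>2 \<le> 2 * (norm (b - a))\<^sup>2 + 2 * (norm b)\<^sup>2"
proof -
  \<comment> \<open>This square is exactly the right-hand side of the claim minus the left-hand
    side.\<close>
  have "0 \<le> (norm (2 *\<^sub>R b - a))\<^sup>2" by simp
  then show ?thesis
    unfolding power2_norm_eq_inner by (simp add: algebra_simps inner_commute)
qed

section \<open>Analysis of a single epoch\<close>

locale smooth_convex_sum =
  fixes L :: real and n :: nat
    and f :: "nat \<Rightarrow> 'a :: euclidean_space \<Rightarrow> real" and g :: "nat \<Rightarrow> 'a \<Rightarrow> 'a"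
  assumes L_pos: "L > 0" and n_pos: "n \<ge> 1"
    and conv: "\<And>i. i \<in> {1..n} \<Longrightarrow> convex_on UNIV (f i)"
    and deriv: "\<And>i x. i \<in> {1..n} \<Longrightarrow> GDERIV (f i) x :> g i x"
    and lip: "\<And>i x y. i \<in> {1..n} \<Longrightarrow> norm (g i x - g i y) \<le> L * norm (x - y)"
begin

text \<open>One \<open>D\<close>, measured at \<open>w\<close>, controls the drift for every
  comparison point \<open>u\<close>. The gain \<open>D / (2 * L)\<close> is kept at
  \<open>u = w\<close>, where it can later be set against the drift.\<close>

lemma epoch_bound:
  assumes p: "p permutes {1..n}" and h: "\<And>i. i \<in> {1..n} \<Longrightarrow> h i = \<eta> / real n"
  obtains G D where "nasg_inner g h p y n = y - \<eta> *\<^sub>R G" and "D \<ge> 0"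
    and "\<And>u. objective n f (nasg_inner g h p y n) - objective n f u
      \<le> G \<bullet> (nasg_inner g h p y n - u) + L * \<eta>\<^sup>2 * (D + grad_variance n g w)"
    and "objective n f (nasg_inner g h p y n) - objective n f w
      \<le> G \<bullet> (nasg_inner g h p y n - w) + L * \<eta>\<^sup>2 * (D + grad_variance n g w) - D / (2 * L)"
proof
  define z where "z i = nasg_inner g h p y i" for i
  define q where "q i = g (p i) (z (i - 1))" for i
  define G where "G = (1 / real n) *\<^sub>R (\<Sum>i = 1..n. q i)"
  define E where "E u = (1 / real n) * (\<Sum>i = 1..n. (norm (g (p i) u - q i))\<^sup>2)" for u
  let ?x = "nasg_inner g h p y n"
  have pin: "p i \<in> {1..n}" if "i \<in> {1..n}" for i
    using that p permutes_in_image by metis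
  \<comment> \<open>Sums over a whole epoch do not see the visiting order. Partial sums do, and they
    enter only through the drift.\<close>
  have reindex: "(\<Sum>i = 1..n. c (p i)) = (\<Sum>i = 1..n. c i)" for c :: "nat \<Rightarrow> real"
    using sum.permute[OF p, of c] by (simp add: o_def)
  have z_eq: "z i = y - (\<eta> / real n) *\<^sub>R (\<Sum>j = 1..i. q j)" if "i \<le> n" for i
    unfolding z_def q_def by (rule nasg_inner_eq_sum) (use h that in auto)
  show "?x = y - \<eta> *\<^sub>R G"
    using z_eq[of n] by (simp add: z_def G_def)
  show E_nonneg: "E u \<ge> 0" for u
    unfolding E_def by (intro mult_nonneg_nonneg sum_nonneg) auto
  have sq: "(1 / real n) * (\<Sum>i = 1..n. (norm (q i))\<^sup>2) \<le> 2 * (E w + grad_variance n g w)"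
  proof -
    have "(\<Sum>i = 1..n. (norm (q i))\<^sup>2)
        \<le> (\<Sum>i = 1..n. 2 * (norm (g (p i) w - q i))\<^sup>2 + 2 * (norm (g (p i) w))\<^sup>2)"
      by (intro sum_mono norm_power2_le_double)
    also have "\<dots> = 2 * (\<Sum>i = 1..n. (norm (g (p i) w - q i))\<^sup>2) + 2 * (\<Sum>i = 1..n. (norm (g i w))\<^sup>2)"
      using reindex[of "\<lambda>i. (norm (g i w))\<^sup>2"] by (simp add: sum.distrib flip: sum_distrib_left)
    finally show ?thesis
      unfolding E_def grad_variance_def using n_pos by (simp add: field_simps)
  qed
  \<comment> \<open>The gap between the end of the epoch and the point where \<open>q i\<close> is
    evaluated consists of the steps \<open>i\<close> to \<open>n\<close>. Enlarging this tail to the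
    full epoch makes the bound uniform in \<open>i\<close>.\<close>
  have drift: "(norm (?x - z (i - 1)))\<^sup>2 \<le> 2 * \<eta>\<^sup>2 * (E w + grad_variance n g w)"
    if i: "i \<in> {1..n}" for i
  proof -
    have "{1..n} = {1..i - 1} \<union> {i..n}" using i by auto
    then have split: "(\<Sum>j = 1..n. q j) = (\<Sum>j = 1..i - 1. q j) + (\<Sum>j = i..n. q j)"
      using i by (subst sum.union_disjoint[symmetric]) auto
    have "z (i - 1) = y - (\<eta> / real n) *\<^sub>R (\<Sum>j = 1..i - 1. q j)"
      using i by (intro z_eq) auto
    moreover have "?x = y - (\<eta> / real n) *\<^sub>R (\<Sum>j = 1..n. q j)"
      using z_eq[of n] by (simp add: z_def)
    ultimately have "?x - z (i - 1) = (\<eta> / real n) *\<^sub>R (\<Sum>j = 1..i - 1. q j)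
        - (\<eta> / real n) *\<^sub>R (\<Sum>j = 1..n. q j)"
      by simp
    then have "?x - z (i - 1) = - ((\<eta> / real n) *\<^sub>R (\<Sum>j = i..n. q j))"
      unfolding split by (simp add: algebra_simps)
    then have "(norm (?x - z (i - 1)))\<^sup>2 = (\<eta> / real n)\<^sup>2 * (norm (\<Sum>j = i..n. q j))\<^sup>2"
      by (simp add: power_mult_distrib power_divide)
    also have "\<dots> \<le> (\<eta> / real n)\<^sup>2 * (real (card {i..n}) * (\<Sum>j = i..n. (norm (q j))\<^sup>2))"
      by (intro mult_left_mono norm_sum_power2_le) simp
    also have "\<dots> \<le> (\<eta> / real n)\<^sup>2 * (real n * (\<Sum>j = 1..n. (norm (q j))\<^sup>2))"
      using i by (intro mult_left_mono mult_mono sum_mono2 sum_nonneg) auto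
    also have "\<dots> = \<eta>\<^sup>2 * ((1 / real n) * (\<Sum>j = 1..n. (norm (q j))\<^sup>2))"
      using n_pos by (simp add: power2_eq_square)
    also have "\<dots> \<le> \<eta>\<^sup>2 * (2 * (E w + grad_variance n g w))"
      by (intro mult_left_mono sq) simp
    finally show ?thesis by (simp only: ac_simps)
  qed
  \<comment> \<open>Both the upper bound at the end point and the lower bound at \<open>u\<close>
    are expanded around \<open>z (i - 1)\<close>, so the value there cancels.\<close>
  have component: "f (p i) ?x - f (p i) u
      \<le> q i \<bullet> (?x - u) + L * \<eta>\<^sup>2 * (E w + grad_variance n g w) - (norm (g (p i) u - q i))\<^sup>2 / (2 * L)"
    if i: "i \<in> {1..n}" for i u
  proof -
    have "f (p i) ?x \<le> f (p i) (z (i - 1)) + q i \<bullet> (?x - z (i - 1)) + L / 2 * (norm (?x - z (i - 1)))\<^sup>2"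
      unfolding q_def by (rule smooth_upper_bound) (use pin[OF i] deriv lip in auto)
    moreover have "L / 2 * (norm (?x - z (i - 1)))\<^sup>2 \<le> L / 2 * (2 * \<eta>\<^sup>2 * (E w + grad_variance n g w))"
      using L_pos by (intro mult_left_mono drift[OF i]) simp
    moreover have "f (p i) u \<ge> f (p i) (z (i - 1)) + q i \<bullet> (u - z (i - 1)) + (norm (g (p i) u - q i))\<^sup>2 / (2 * L)"
      unfolding q_def by (rule smooth_convex_lower_bound) (use pin[OF i] deriv lip conv L_pos in auto)
    ultimately show ?thesis by (simp add: inner_diff_right)
  qed
  have bound: "objective n f ?x - objective n f u
      \<le> G \<bullet> (?x - u) + L * \<eta>\<^sup>2 * (E w + grad_variance n g w) - E u / (2 * L)" for u
  proof -
    have "objective n f ?x - objective n f u = (1 / real n) * (\<Sum>i = 1..n. f (p i) ?x - f (p i) u)"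
      using reindex[of "\<lambda>i. f i ?x"] reindex[of "\<lambda>i. f i u"]
      by (simp add: objective_def sum_subtractf diff_divide_distrib)
    also have "\<dots> \<le> (1 / real n) * (\<Sum>i = 1..n. q i \<bullet> (?x - u)
        + L * \<eta>\<^sup>2 * (E w + grad_variance n g w) - (norm (g (p i) u - q i))\<^sup>2 / (2 * L))"
      by (intro mult_left_mono sum_mono component) auto
    also have "\<dots> = G \<bullet> (?x - u) + L * \<eta>\<^sup>2 * (E w + grad_variance n g w) - E u / (2 * L)"
      using n_pos L_pos
      by (simp add: G_def E_def sum.distrib sum_subtractf inner_sum_left sum_divide_distrib[symmetric]
          add_divide_distrib diff_divide_distrib)
    finally show ?thesis .
  qed
  show "objective n f ?x - objective n f w
      \<le> G \<bullet> (?x - w) + L * \<eta>\<^sup>2 * (E w + grad_variance n g w) - E w / (2 * L)"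
    by (rule bound)
  show "objective n f ?x - objective n f u
      \<le> G \<bullet> (?x - u) + L * \<eta>\<^sup>2 * (E w + grad_variance n g w)" for u
    using bound[of u] E_nonneg[of u] L_pos by (smt (verit) divide_nonneg_pos)
qed

text \<open>In terms of \<open>v\<close> the epoch is a gradient step of length
  \<open>\<eta> / \<theta>\<close>, so the mixed inner products become a difference of squared
  distances to \<open>w\<close>. The condition
  \<open>2 * (L * \<eta>)\<^sup>2 \<le> \<theta>\<close> is what lets the gain at \<open>w\<close>
  absorb the \<open>D\<close> part of the drift.\<close>

lemma momentum_step:
  assumes p: "p permutes {1..n}" and h: "\<And>i. i \<in> {1..n} \<Longrightarrow> h i = \<eta> / real n"
    and \<theta>: "0 < \<theta>" "\<theta> \<le> 1" and \<eta>: "\<eta> > 0" "2 * (L * \<eta>)\<^sup>2 \<le> \<theta>"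
    and y: "y = (1 - \<theta>) *\<^sub>R x + \<theta> *\<^sub>R v"
    and x': "x' = nasg_inner g h p y n" and v': "v' = x + (1 / \<theta>) *\<^sub>R (x' - x)"
  shows "\<eta> / \<theta>\<^sup>2 * (objective n f x' - objective n f w) + (norm (v' - w))\<^sup>2 / 2
    \<le> \<eta> / \<theta>\<^sup>2 * (1 - \<theta>) * (objective n f x - objective n f w) + (norm (v - w))\<^sup>2 / 2
      + \<eta> / \<theta>\<^sup>2 * (L * \<eta>\<^sup>2 * grad_variance n g w)"
proof -
  let ?F = "objective n f" and ?s = "grad_variance n g w"
  obtain G D where xG: "x' = y - \<eta> *\<^sub>R G" and "D \<ge> 0"
    and bx: "\<And>u. ?F x' - ?F u \<le> G \<bullet> (x' - u) + L * \<eta>\<^sup>2 * (D + ?s)"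
    and bw: "?F x' - ?F w \<le> G \<bullet> (x' - w) + L * \<eta>\<^sup>2 * (D + ?s) - D / (2 * L)"
    by (rule epoch_bound[where p = p and h = h and \<eta> = \<eta> and y = y and w = w, folded x'])
      (rule p, erule h, rule that)
  have D: "L * \<eta>\<^sup>2 * D \<le> \<theta> * (D / (2 * L))"
  proof -
    have "L * \<eta>\<^sup>2 * D = (2 * (L * \<eta>)\<^sup>2) * (D / (2 * L))"
      using L_pos by (simp add: power2_eq_square)
    also have "\<dots> \<le> \<theta> * (D / (2 * L))"
      using \<eta> \<open>D \<ge> 0\<close> L_pos by (intro mult_right_mono) auto
    finally show ?thesis .
  qed
  have "(1 - \<theta>) * (?F x' - ?F x) \<le> (1 - \<theta>) * (G \<bullet> (x' - x) + L * \<eta>\<^sup>2 * (D + ?s))"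
    using bx[of x] \<theta> by (intro mult_left_mono) auto
  moreover have "\<theta> * (?F x' - ?F w) \<le> \<theta> * (G \<bullet> (x' - w) + L * \<eta>\<^sup>2 * (D + ?s) - D / (2 * L))"
    using bw \<theta> by (intro mult_left_mono) auto
  ultimately have "(?F x' - ?F w) - (1 - \<theta>) * (?F x - ?F w)
      \<le> (1 - \<theta>) * (G \<bullet> (x' - x)) + \<theta> * (G \<bullet> (x' - w)) + L * \<eta>\<^sup>2 * ?s"
    using D by (simp add: algebra_simps)
  \<comment> \<open>By the choice of \<open>y\<close>, the weighted displacement from
    \<open>x\<close> and \<open>w\<close> to \<open>x'\<close> is
    \<open>\<theta> *\<^sub>R (v - w) - \<eta> *\<^sub>R G\<close>.\<close>
  also have "(1 - \<theta>) * (G \<bullet> (x' - x)) + \<theta> * (G \<bullet> (x' - w)) = \<theta> * (G \<bullet> (v - w)) - \<eta> * (norm G)\<^sup>2"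
    unfolding xG y power2_norm_eq_inner by (simp add: algebra_simps)
  finally have main: "(?F x' - ?F w) - (1 - \<theta>) * (?F x - ?F w)
      \<le> \<theta> * (G \<bullet> (v - w)) - \<eta> * (norm G)\<^sup>2 + L * \<eta>\<^sup>2 * ?s" .
  have "v' = v - (\<eta> / \<theta>) *\<^sub>R G"
  proof -
    have "x' - x = \<theta> *\<^sub>R (v - x) - \<eta> *\<^sub>R G" unfolding xG y by (simp add: algebra_simps)
    then show ?thesis unfolding v' using \<theta> by (simp add: scaleR_diff_right)
  qed
  then have eq: "v' - w = (v - w) - (\<eta> / \<theta>) *\<^sub>R G"
    by (simp add: diff_right_commute)
  have "(norm (a - r *\<^sub>R G))\<^sup>2 = (norm a)\<^sup>2 - 2 * r * (G \<bullet> a) + r\<^sup>2 * (norm G)\<^sup>2" for a and r :: real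
    unfolding power2_norm_eq_inner by (simp add: inner_commute power2_eq_square algebra_simps)
  then have norm_eq: "(norm (v' - w))\<^sup>2
      = (norm (v - w))\<^sup>2 - 2 * (\<eta> / \<theta>) * (G \<bullet> (v - w)) + (\<eta> / \<theta>)\<^sup>2 * (norm G)\<^sup>2"
    unfolding eq .
  \<comment> \<open>Half of the available \<open>(\<eta> / \<theta>)\<^sup>2 * M\<close> pays for
    the squared step of \<open>v\<close>. The other half has a favourable sign and is dropped at the
    end.\<close>
  have "(N - 2 * (\<eta> / \<theta>) * q + (\<eta> / \<theta>)\<^sup>2 * M) / 2 - N / 2
      = - (\<eta> / \<theta>\<^sup>2 * (\<theta> * q - \<eta> * M)) - (\<eta> / \<theta>)\<^sup>2 * M / 2" for N q M :: real
    using \<theta> by (simp add: field_simps power2_eq_square)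
  then have dist: "(norm (v' - w))\<^sup>2 / 2 - (norm (v - w))\<^sup>2 / 2
      = - (\<eta> / \<theta>\<^sup>2 * (\<theta> * (G \<bullet> (v - w)) - \<eta> * (norm G)\<^sup>2)) - (\<eta> / \<theta>)\<^sup>2 * (norm G)\<^sup>2 / 2"
    unfolding norm_eq .
  have scaled: "\<eta> / \<theta>\<^sup>2 * ((?F x' - ?F w) - (1 - \<theta>) * (?F x - ?F w))
      \<le> \<eta> / \<theta>\<^sup>2 * (\<theta> * (G \<bullet> (v - w)) - \<eta> * (norm G)\<^sup>2 + L * \<eta>\<^sup>2 * ?s)"
    using main \<eta> by (intro mult_left_mono) auto
  have combine: "A * a + N' / 2 \<le> A * (1 - \<theta>) * b + N / 2 + A * s"
    if "N' / 2 - N / 2 = - (A * q) - r" and "A * (a - (1 - \<theta>) * b) \<le> A * (q + s)" and "0 \<le> r"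
    for A a b q r s N N' :: real
    using that by (simp add: algebra_simps)
  show ?thesis
    by (rule combine[OF dist scaled]) simp
qed

end

section \<open>Summation over the epochs\<close>

theorem theorem4p1:
  fixes L \<alpha> k :: real and n T :: nat
    and f :: "nat \<Rightarrow> 'a :: euclidean_space \<Rightarrow> real"
    and g :: "nat \<Rightarrow> 'a \<Rightarrow> 'a"
    and \<gamma> \<eta> :: "nat \<Rightarrow> real" and h :: "nat \<Rightarrow> nat \<Rightarrow> real"
    and \<pi> :: "nat \<Rightarrow> nat \<Rightarrow> nat"
    and x0 y0 xstar :: 'a
  assumes "L > 0" and "n \<ge> 1" and "T \<ge> 2"
    and "\<And>i. i \<in> {1..n} \<Longrightarrow> convex_on UNIV (f i)"
    and "\<And>i x. i \<in> {1..n} \<Longrightarrow> GDERIV (f i) x :> g i x"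
    and "\<And>i x y. i \<in> {1..n} \<Longrightarrow> norm (g i x - g i y) \<le> L * norm (x - y)"
    and "\<And>w. objective n f xstar \<le> objective n f w"
    and "\<And>t. t \<in> {1..T} \<Longrightarrow> \<pi> t permutes {1..n}"
    and "\<And>t. t \<in> {1..T} \<Longrightarrow> \<gamma> t = (real t - 1) / (real t + 2)"
    and "\<alpha> = 1 + 1 / real T"
    and "k = 1 / (exp 1 * \<alpha> * root 3 12)"
    and "\<And>t. t \<in> {1..T} \<Longrightarrow> \<eta> t = k * \<alpha> ^ t / (L * real T)"
    and "\<And>t i. t \<in> {1..T} \<Longrightarrow> i \<in> {1..n} \<Longrightarrow> h t i = \<eta> t / real n"
    and "y0 = x0"
  shows "objective n f (fst (nasg n g \<gamma> h \<pi> x0 y0 T)) - objective n f xstar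
    \<le> 4 * grad_variance n g xstar / (9 * L * real T)
      + 2 * L * exp 1 * root 3 12 / real T * (norm (x0 - xstar))\<^sup>2"
proof -
  interpret smooth_convex_sum L n f g
    by unfold_locales (use assms in auto)
  let ?F = "objective n f" and ?s = "grad_variance n g xstar"
  define X where "X t = fst (nasg n g \<gamma> h \<pi> x0 y0 t)" for t
  define Y where "Y t = snd (nasg n g \<gamma> h \<pi> x0 y0 t)" for t
  \<comment> \<open>The auxiliary sequence for which \<open>Y t\<close> is the convex combination of \<open>X t\<close> and \<open>V t\<close> with
    weight \<open>2 / (t + 2)\<close> on \<open>V t\<close>.\<close>
  define V where "V t = (if t = 0 then x0 else X (t - 1) + ((real t + 1) / 2) *\<^sub>R (X t - X (t - 1)))" for t
  \<comment> \<open>The step size that remains after dividing \<open>\<eta> t\<close> by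
    \<open>\<alpha> ^ t\<close>.\<close>
  define c where "c = k / (L * real T)"
  \<comment> \<open>A noise bound valid for every epoch: the largest weight
    \<open>c / \<theta>\<^sup>2\<close>, reached in epoch \<open>T\<close>, times the bound on
    \<open>L * (\<eta> t)\<^sup>2 * ?s\<close> that follows from
    \<open>L * \<eta> t \<le> 1 / (2 * real T)\<close>.\<close>
  define C where "C = c * (real T + 1)\<^sup>2 / 4 * (?s / (4 * L * (real T)\<^sup>2))"
  have XS: "X (Suc t) = nasg_inner g (h (Suc t)) (\<pi> (Suc t)) (Y t) n" for t
    by (simp add: X_def Y_def Let_def split: prod.split)
  have YS: "Y (Suc t) = X (Suc t) + \<gamma> (Suc t) *\<^sub>R (X (Suc t) - X t)" for t
    by (simp add: X_def Y_def Let_def split: prod.split)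
  have T: "real T \<ge> 2" and L: "L > 0" using assms by auto
  have \<alpha>: "\<alpha> \<ge> 1" "\<alpha> > 0" using assms(10) T by (auto simp: add_pos_nonneg)
  \<comment> \<open>From 8 \<le> 12; this supplies the factor 2 in
    \<open>L * \<eta> t \<le> 1 / (2 * real T)\<close>.\<close>
  have root12: "root 3 12 \<ge> 2"
  proof -
    have "root 3 (2 ^ 3) \<le> root 3 (12::real)" by (subst real_root_le_iff) auto
    then show ?thesis by (simp add: real_root_power_cancel del: power_numeral)
  qed
  have k: "k > 0" using assms(11) \<alpha> root12 by simp
  have c: "c > 0" using k L T by (simp add: c_def)
  have \<eta>: "\<eta> t = c * \<alpha> ^ t" "\<eta> t > 0" "L * \<eta> t \<le> 1 / (2 * real T)" if t: "t \<in> {1..T}" for t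
  proof -
    show eq: "\<eta> t = c * \<alpha> ^ t" using assms(12)[OF t] by (simp add: c_def)
    then show "\<eta> t > 0" using c \<alpha> by simp
    \<comment> \<open>One factor \<open>\<alpha>\<close> of \<open>\<alpha> ^ t\<close> cancels
      against \<open>k\<close>; the other \<open>t - 1\<close> factors stay below Euler's number,
      which \<open>k\<close> also divides out.\<close>
    have "\<alpha> ^ (t - 1) \<le> exp (1 / real T) ^ (t - 1)"
      using \<alpha> assms(10) exp_ge_add_one_self[of "1 / real T"] by (intro power_mono) auto
    also have "\<dots> = exp (real (t - 1) * (1 / real T))" by (simp only: exp_of_nat_mult)
    also have "\<dots> \<le> exp 1" using t T by (auto simp: divide_simps)
    finally have growth: "\<alpha> ^ (t - 1) / exp 1 \<le> 1" by simp
    have "\<alpha> ^ t = \<alpha> * \<alpha> ^ (t - 1)" using t by (cases t) auto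
    then have "L * \<eta> t = (\<alpha> ^ (t - 1) / exp 1) * (1 / root 3 12) / real T"
      unfolding eq c_def assms(11) using L \<alpha> by simp
    also have "\<dots> \<le> 1 * (1 / 2) / real T"
      using growth \<alpha> root12 by (intro divide_right_mono mult_mono divide_left_mono) auto
    finally have "L * \<eta> t \<le> 1 * (1 / 2) / real T" .
    then show "L * \<eta> t \<le> 1 / (2 * real T)" by simp
  qed
  have s_nonneg: "?s \<ge> 0"
    unfolding grad_variance_def by (intro mult_nonneg_nonneg sum_nonneg) auto
  \<comment> \<open>At \<open>t = 0\<close> the weight on \<open>V t\<close> is 1, and
    \<open>y0 = x0\<close> is what makes the identity true. For later \<open>t\<close>, this weight
    times the extrapolation factor \<open>(real t - 1) / 2\<close> is exactly
    \<open>\<gamma> t\<close>.\<close>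
  have Y_eq: "Y t = (1 - 2 / (real t + 2)) *\<^sub>R X t + (2 / (real t + 2)) *\<^sub>R V t" if "t \<le> T" for t
  proof (cases t)
    case 0
    then show ?thesis using assms(14) by (simp add: X_def Y_def V_def)
  next
    case (Suc u)
    have \<gamma>: "\<gamma> t = (real t - 1) / (real t + 2)" using assms(9)[of t] Suc that by auto
    have "(real t + 1) / 2 = 1 + (real t - 1) / 2" by (simp add: field_simps)
    then have "V t = X u + (1 + (real t - 1) / 2) *\<^sub>R (X t - X u)"
      unfolding V_def using Suc by simp
    then have V: "V t = X t + ((real t - 1) / 2) *\<^sub>R (X t - X u)"
      by (simp only: scaleR_add_left scaleR_one) simp
    have comb: "(1 - a) *\<^sub>R X t + a *\<^sub>R (X t + b *\<^sub>R d) = X t + (a * b) *\<^sub>R d" for a b :: real and d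
      by (simp add: algebra_simps)
    have "2 / (real t + 2) * ((real t - 1) / 2) = (real t - 1) / (real t + 2)"
      by (simp add: field_simps)
    moreover have "Y t = X t + \<gamma> t *\<^sub>R (X t - X u)"
      using YS[of u] Suc by simp
    ultimately show ?thesis
      by (simp only: V comb \<gamma>)
  qed
  \<comment> \<open>The coefficient of the objective gap vanishes at \<open>t = 0\<close>, so the
    start contributes only its distance to \<open>xstar\<close>.\<close>
  have bound: "c * ((real t + 1)\<^sup>2 - 1) / 4 * (?F (X t) - ?F xstar) + (norm (V t - xstar))\<^sup>2 / (2 * \<alpha> ^ t)
      \<le> (norm (x0 - xstar))\<^sup>2 / 2 + real t * C" if "t \<le> T" for t
    using that
  proof (induction t)
    case 0
    then show ?case by (simp add: V_def)
  next
    case (Suc t)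
    let ?t = "Suc t"
    define \<theta> where "\<theta> = 2 / (real t + 2)"
    have tT: "?t \<in> {1..T}" using Suc.prems by auto
    have \<theta>: "0 < \<theta>" "\<theta> \<le> 1" "1 / \<theta> = (real t + 2) / 2" "1 / real T \<le> \<theta>"
      using Suc.prems T by (auto simp: \<theta>_def field_simps)
    have sq: "(L * \<eta> ?t)\<^sup>2 \<le> 1 / (4 * (real T)\<^sup>2)"
    proof -
      have "(L * \<eta> ?t)\<^sup>2 \<le> (1 / (2 * real T))\<^sup>2"
        using \<eta>(2,3)[OF tT] L by (intro power_mono) auto
      then show ?thesis by (simp add: power_divide power_mult_distrib)
    qed
    have "2 * (L * \<eta> ?t)\<^sup>2 \<le> 1 / real T"
    proof -
      have "2 * (1 / (4 * (real T)\<^sup>2)) \<le> 1 / real T"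
        using T by (simp add: field_simps power2_eq_square)
      then show ?thesis using sq by linarith
    qed
    then have small: "2 * (L * \<eta> ?t)\<^sup>2 \<le> \<theta>" using \<theta>(4) by linarith
    have vV: "V ?t = X t + (1 / \<theta>) *\<^sub>R (X ?t - X t)"
      unfolding \<theta>(3) by (simp add: V_def add.commute)
    have "\<eta> ?t / \<theta>\<^sup>2 * (?F (X ?t) - ?F xstar) + (norm (V ?t - xstar))\<^sup>2 / 2
        \<le> \<eta> ?t / \<theta>\<^sup>2 * (1 - \<theta>) * (?F (X t) - ?F xstar) + (norm (V t - xstar))\<^sup>2 / 2
          + \<eta> ?t / \<theta>\<^sup>2 * (L * (\<eta> ?t)\<^sup>2 * ?s)"
      by (rule momentum_step[OF assms(8)[OF tT] assms(13)[OF tT] \<theta>(1,2) \<eta>(2)[OF tT] small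
            Y_eq[of t, folded \<theta>_def] XS vV]) (use Suc.prems in auto)
    then have divided: "(\<eta> ?t / \<theta>\<^sup>2 * (?F (X ?t) - ?F xstar) + (norm (V ?t - xstar))\<^sup>2 / 2) / \<alpha> ^ ?t
        \<le> (\<eta> ?t / \<theta>\<^sup>2 * (1 - \<theta>) * (?F (X t) - ?F xstar) + (norm (V t - xstar))\<^sup>2 / 2
          + \<eta> ?t / \<theta>\<^sup>2 * (L * (\<eta> ?t)\<^sup>2 * ?s)) / \<alpha> ^ ?t"
      using \<alpha> by (intro divide_right_mono) auto
    have step: "c / \<theta>\<^sup>2 * (?F (X ?t) - ?F xstar) + (norm (V ?t - xstar))\<^sup>2 / (2 * \<alpha> ^ ?t)
        \<le> c / \<theta>\<^sup>2 * (1 - \<theta>) * (?F (X t) - ?F xstar) + (norm (V t - xstar))\<^sup>2 / (2 * \<alpha> ^ ?t)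
          + c / \<theta>\<^sup>2 * (L * (\<eta> ?t)\<^sup>2 * ?s)"
    proof -
      have "\<eta> ?t / \<theta>\<^sup>2 * a / \<alpha> ^ ?t = c / \<theta>\<^sup>2 * a" for a
        unfolding \<eta>(1)[OF tT] using \<alpha> by simp
      then have *: "(\<eta> ?t / \<theta>\<^sup>2 * a + d / 2) / \<alpha> ^ ?t = c / \<theta>\<^sup>2 * a + d / (2 * \<alpha> ^ ?t)" for a d
        by (simp add: add_divide_distrib)
      have "(\<eta> ?t / \<theta>\<^sup>2 * b * a + d / 2 + \<eta> ?t / \<theta>\<^sup>2 * e) / \<alpha> ^ ?t
          = c / \<theta>\<^sup>2 * b * a + d / (2 * \<alpha> ^ ?t) + c / \<theta>\<^sup>2 * e" for a b d e
        using *[of "b * a + e" d] by (simp add: algebra_simps add_divide_distrib)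
      with * show ?thesis
        using divided by (simp only:)
    qed
    \<comment> \<open>With u = t + 1 the new gap gets weight \<open>c * (u + 1)\<^sup>2 / 4\<close>
      and the old one \<open>c * (u\<^sup>2 - 1) / 4\<close>, which is the coefficient in the
      induction hypothesis.\<close>
    have coeff: "c / \<theta>\<^sup>2 = c * (real ?t + 1)\<^sup>2 / 4"
      by (simp add: \<theta>_def field_simps power2_eq_square)
    have coeff': "c / \<theta>\<^sup>2 * (1 - \<theta>) = c * ((real t + 1)\<^sup>2 - 1) / 4"
      by (simp add: \<theta>_def field_simps power2_eq_square)
    have "L * (\<eta> ?t)\<^sup>2 * ?s \<le> ?s / (4 * L * (real T)\<^sup>2)"
    proof -
      have "L * (\<eta> ?t)\<^sup>2 * ?s = (L * \<eta> ?t)\<^sup>2 * (?s / L)"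
        using L by (simp add: power2_eq_square)
      also have "\<dots> \<le> 1 / (4 * (real T)\<^sup>2) * (?s / L)"
        using sq s_nonneg L by (intro mult_right_mono) auto
      finally show ?thesis by (simp add: ac_simps)
    qed
    moreover have "c * (real ?t + 1)\<^sup>2 / 4 \<le> c * (real T + 1)\<^sup>2 / 4"
      using Suc.prems c by (intro divide_right_mono mult_left_mono power_mono) auto
    ultimately have noise: "c / \<theta>\<^sup>2 * (L * (\<eta> ?t)\<^sup>2 * ?s) \<le> C"
      unfolding C_def coeff using c L s_nonneg by (intro mult_mono) auto
    have dist: "(norm (V t - xstar))\<^sup>2 / (2 * \<alpha> ^ ?t) \<le> (norm (V t - xstar))\<^sup>2 / (2 * \<alpha> ^ t)"
      using \<alpha> by (intro divide_left_mono) auto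
    \<comment> \<open>The new weight exceeds what the potential asks for by \<open>c / 4\<close>;
      the surplus may be discarded because \<open>xstar\<close> is a minimizer.\<close>
    have "c * ((real ?t + 1)\<^sup>2 - 1) / 4 * (?F (X ?t) - ?F xstar)
        \<le> c / \<theta>\<^sup>2 * (?F (X ?t) - ?F xstar)"
      unfolding coeff using c assms(7)[of "X ?t"]
      by (intro mult_right_mono divide_right_mono mult_left_mono) auto
    with step noise dist Suc show ?case
      unfolding coeff' by (simp add: algebra_simps)
  qed

  \<comment> \<open>The final constants\<close>
  have "c * ((real T + 1)\<^sup>2 - 1) / 4 * (?F (X T) - ?F xstar)
      \<le> (norm (x0 - xstar))\<^sup>2 / 2 + real T * C"
    using bound[of T] \<alpha> by (smt (verit) divide_nonneg_pos zero_le_power2 zero_less_power order_refl)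
  moreover have "c * ((real T + 1)\<^sup>2 - 1) / 4 = c * real T * (real T + 2) / 4"
    by (simp add: power2_eq_square algebra_simps)
  ultimately have "?F (X T) - ?F xstar
      \<le> ((norm (x0 - xstar))\<^sup>2 / 2 + real T * C) / (c * real T * (real T + 2) / 4)"
    using c T by (subst pos_le_divide_eq) (auto simp: mult.commute)
  also have "\<dots> = 2 / (c * real T * (real T + 2)) * (norm (x0 - xstar))\<^sup>2
      + (real T + 1)\<^sup>2 / (4 * real T * (real T + 2)) * (?s / (L * real T))"
  proof -
    have quotient: "(R / 2 + a * (c * b / 4 * (q / (4 * l * a\<^sup>2)))) / (c * a * d / 4)
        = 2 / (c * a * d) * R + b / (4 * a * d) * (q / (l * a))"
      if "a > 0" "d > 0" "l > 0" for R a b d l q :: real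
      using that c by (simp add: field_simps power2_eq_square)
    show ?thesis unfolding C_def by (rule quotient) (use T L in auto)
  qed
  also have "\<dots> \<le> 2 * L * exp 1 * root 3 12 / real T * (norm (x0 - xstar))\<^sup>2
      + 4 / 9 * (?s / (L * real T))"
  proof (intro add_mono mult_right_mono)
    \<comment> \<open>The factor \<open>\<alpha>\<close> in \<open>k\<close> puts
      \<open>real T + 1\<close> into \<open>1 / c\<close>; the factor \<open>real T + 2\<close> of
      the denominator outweighs it, which leaves the rate 1/T.\<close>
    have "2 / (c * real T * (real T + 2))
        = 2 * L * exp 1 * root 3 12 / real T * ((real T + 1) / (real T + 2))"
    proof -
      have "\<alpha> * real T = real T + 1" using assms(10) T by (simp add: field_simps)
      then have "1 / c = exp 1 * root 3 12 * L * (real T + 1)"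
        unfolding c_def assms(11) using T by (simp add: ac_simps)
      then show ?thesis by (simp add: divide_inverse ac_simps)
    qed
    also have "\<dots> \<le> 2 * L * exp 1 * root 3 12 / real T * 1"
      using L T root12 by (intro mult_left_mono) auto
    finally show "2 / (c * real T * (real T + 2)) \<le> 2 * L * exp 1 * root 3 12 / real T" by simp
    \<comment> \<open>This amounts to \<open>9 \<le> 7 * a\<^sup>2 + 14 * a\<close> and is the
      source of the constant 4/9.\<close>
    have "9 * (a + 1)\<^sup>2 \<le> 4 * (4 * a * (a + 2))" if "a \<ge> 2" for a :: real
      using mult_mono[of 2 a 2 a] that by (simp add: power2_eq_square algebra_simps)
    from this[OF T] have "(real T + 1)\<^sup>2 \<le> 4 / 9 * (4 * real T * (real T + 2))"
      by linarith
    then show "(real T + 1)\<^sup>2 / (4 * real T * (real T + 2)) \<le> 4 / 9"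
      by (subst pos_divide_le_eq) (use T in auto)
  qed (use s_nonneg L in auto)
  finally show ?thesis by (simp add: X_def)
qed

end
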